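(* Let $(X,\mu,\mathcal{E},\mathcal{F})$ be a Dirichlet space whose heat kernel satisfies $p_t(x,y)\le C_ht^{-\beta}$ for $\mu\times\mu$-a.e. $(x,y)\in X\times X$ and every $t>0$, for some constants $C_h>0$ and $\beta>0$. Assume that condition $(\mathrm{PPI}_p)$ is satisfied for some $p\ge1$ such that $p\alpha_p<\beta$. Let $r,s\in[1,+\infty]$ and $\theta\in(0,1]$ be related by the identity $$\frac1r=\theta\Big(\frac1p-\frac{\alpha_p}{\beta}\Big)+\frac{1-\theta}{s}.$$ Then there exists a constant $C_{p,r,s}>0$ such that for every $f\in W^{1,p}(\mathcal{E})$ (or $f\in BV(\mathcal{E})$ if $p=1$), $$\|f\|_{L^r(X,\mu)}\le C_{p,r,s}\,\mathbf{Var}_{p,\mathcal{E}}(f)^{\theta}\,\|f\|_{L^s(X,\mu)}^{1-\theta}.$$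
   Context: $X$ is a good measurable space (like a Polish or Radon space) with a $\sigma$-finite measure $\mu$ supported on $X$, and $(\mathcal{E},\mathcal{F})$, $\mathcal{F}=\mathrm{dom}\,\mathcal{E}$, is a Dirichlet form on $L^2(X,\mu)$. Its heat semigroup $\{P_t\}_{t\ge0}$, extended to all $L^p(X,\mu)$, $1\le p\le\infty$, is assumed conservative ($P_t1=1$), and it admits a measurable heat kernel $p_t(x,y)$. For $p\ge1$, $\alpha\ge0$ (with $P_t(|f-f(y)|^p)(y)$ meaning $P_t$ applied to $x\mapsto|f(x)-f(y)|^p$, evaluated at $y$), $$\mathbf{B}^{p,\alpha}(X)=\Big\{f\in L^p(X,\mu):\limsup_{t\to0^+}t^{-\alpha}\Big(\int_XP_t(|f-f(y)|^p)(y)\,d\mu(y)\Big)^{1/p}<\infty\Big\}.$$ Set $\alpha_p=\sup\{\alpha>0:\mathbf{B}^{p,\alpha}(X)\text{ contains non a.e. constant functions}\}$ (understood to be a finite positive number), $W^{1,p}(\mathcal{E})=\mathbf{B}^{p,\alpha_p}(X)$ for $p>1$, $BV(\mathcal{E})=\mathbf{B}^{1,\alpha_1}(X)$, and for $f$ in these classes $$\mathbf{Var}_{p,\mathcal{E}}(f)=\liminf_{t\to0^+}t^{-\alpha_p}\Big(\int_XP_t(|f-f(y)|^p)(y)\,d\mu(y)\Big)^{1/p}.$$ Condition $(\mathrm{PPI}_p)$: there is a constant $C_p>0$ such that $\|P_tf-f\|_{L^p(X,\mu)}\le C_p\,t^{\alpha_p}\,\mathbf{Var}_{p,\mathcal{E}}(f)$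 for every $t\ge0$ and $f\in W^{1,p}(\mathcal{E})$ (or $f\in BV(\mathcal{E})$ if $p=1$). *)

theory Defs
  imports "HOL-Probability.Probability"
begin

text \<open>
  Elements of \<open>L\<^sup>q\<close> are represented by measurable real functions; equality of classes is
  almost-everywhere equality, and every operation below is required to respect it.
  Norms and variations are \<open>ennreal\<close>-valued, so that \<open>\<infinity>\<close> is a genuine value.
\<close>

text \<open>Real powers of extended nonnegative reals, with \<open>x\<^sup>0 = 1\<close> also for \<open>x = 0\<close> and \<open>x = \<infinity>\<close>.
  Used for exponents \<open>a \<ge> 0\<close> only.\<close>

definition epowr :: "ennreal \<Rightarrow> real \<Rightarrow> ennreal" where
  "epowr x a = (if a = 0 then 1 else if x = \<top> then \<top> else ennreal (enn2real x powr a))"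

definition Lp_norm :: "'a measure \<Rightarrow> ennreal \<Rightarrow> ('a \<Rightarrow> real) \<Rightarrow> ennreal" where
  "Lp_norm M q f =
     (if q = \<top> then esssup M (\<lambda>x. ennreal \<bar>f x\<bar>)
      else epowr (\<integral>\<^sup>+x. ennreal (\<bar>f x\<bar> powr enn2real q) \<partial>M) (1 / enn2real q))"

definition Lp_fun :: "'a measure \<Rightarrow> ennreal \<Rightarrow> ('a \<Rightarrow> real) set" where
  "Lp_fun M q = {f \<in> borel_measurable M. Lp_norm M q f < \<top>}"

definition L2_inner :: "'a measure \<Rightarrow> ('a \<Rightarrow> real) \<Rightarrow> ('a \<Rightarrow> real) \<Rightarrow> real" where
  "L2_inner M f g = (LINT x|M. f x * g x)"

text \<open>A good measurable space: a countable family generates the \<open>\<sigma>\<close>-algebra (up to null sets),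
  and the measure decomposition theorem holds, i.e. every finite measure on the product with
  itself is \<open>\<gamma>(dx dy) = \<kappa>(x, dy) \<gamma>\<^sub>1(dx)\<close> for a probability kernel \<open>\<kappa>\<close>, where \<open>\<gamma>\<^sub>1\<close> is its first
  marginal. Polish spaces with a Borel measure are the standard example.\<close>

definition good_measurable_space :: "'a measure \<Rightarrow> bool" where
  "good_measurable_space M \<longleftrightarrow>
     (\<exists>G. countable G \<and> G \<subseteq> sets M \<and>
        (\<forall>A\<in>sets M. \<exists>B\<in>sigma_sets (space M) G. AE x in M. x \<in> A \<longleftrightarrow> x \<in> B)) \<and>
     (\<forall>\<gamma>. sets \<gamma> = sets (M \<Otimes>\<^sub>M M) \<and> finite_measure \<gamma> \<longrightarrow>
        (\<exists>\<kappa>\<in>M \<rightarrow>\<^sub>M prob_algebra M. \<forall>A\<in>sets (M \<Otimes>\<^sub>M M).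
           emeasure \<gamma> A = (\<integral>\<^sup>+x. emeasure (\<kappa> x) (Pair x -` A) \<partial>distr \<gamma> M fst)))"

text \<open>\<open>F\<close> is the domain of the form \<open>E\<close>; the values of \<open>E\<close> outside \<open>F \<times> F\<close> are irrelevant.\<close>

locale dirichlet_space = sigma_finite_measure M
  for M :: "'a measure"
    and E :: "('a \<Rightarrow> real) \<Rightarrow> ('a \<Rightarrow> real) \<Rightarrow> real"
    and F :: "('a \<Rightarrow> real) set" +
  assumes good: "good_measurable_space M"
    and dom_L2: "F \<subseteq> Lp_fun M 2"
    and dom_AE: "\<And>f g. f \<in> F \<Longrightarrow> g \<in> borel_measurable M \<Longrightarrow> (AE x in M. f x = g x) \<Longrightarrow> g \<in> F"
    and form_AE: "\<And>f g h. f \<in> F \<Longrightarrow> g \<in> F \<Longrightarrow> h \<in> F \<Longrightarrow> (AE x in M. f x = g x) \<Longrightarrow> E f h = E g h"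
    and dom_linear: "\<And>f g a b. f \<in> F \<Longrightarrow> g \<in> F \<Longrightarrow> (\<lambda>x. a * f x + b * g x) \<in> F"
    and dom_dense: "\<And>f e. f \<in> Lp_fun M 2 \<Longrightarrow> 0 < e \<Longrightarrow>
           \<exists>g\<in>F. Lp_norm M 2 (\<lambda>x. f x - g x) < ennreal e"
    and form_linear: "\<And>f g h a b. f \<in> F \<Longrightarrow> g \<in> F \<Longrightarrow> h \<in> F \<Longrightarrow>
           E (\<lambda>x. a * f x + b * g x) h = a * E f h + b * E g h"
    and form_sym: "\<And>f g. f \<in> F \<Longrightarrow> g \<in> F \<Longrightarrow> E f g = E g f"
    and form_nonneg: "\<And>f. f \<in> F \<Longrightarrow> 0 \<le> E f f"
    and form_closed: "\<And>u :: nat \<Rightarrow> 'a \<Rightarrow> real.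
           (\<forall>n. u n \<in> F) \<Longrightarrow>
           (\<forall>e>0. \<exists>N. \<forall>m\<ge>N. \<forall>n\<ge>N. let d = (\<lambda>x. u m x - u n x) in E d d + L2_inner M d d < e) \<Longrightarrow>
           \<exists>v\<in>F. (\<lambda>n. let d = (\<lambda>x. u n x - v x) in E d d + L2_inner M d d) \<longlonglongrightarrow> 0"
    and form_markov: "\<And>f. f \<in> F \<Longrightarrow>
           (\<lambda>x. min 1 (max 0 (f x))) \<in> F \<and>
           E (\<lambda>x. min 1 (max 0 (f x))) (\<lambda>x. min 1 (max 0 (f x))) \<le> E f f"

text \<open>The heat semigroup on \<open>L\<^sup>2\<close>: the strongly continuous symmetric contraction semigroup whose
  infinitesimal generator \<open>L\<close> is the operator of the form, that is,
  \<open>L f = h\<close> iff \<open>f \<in> F\<close> and \<open>E(f, g) = - \<langle>h, g\<rangle>\<close> for all \<open>g \<in> F\<close>.\<close>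

definition heat_semigroup ::
  "'a measure \<Rightarrow> (('a \<Rightarrow> real) \<Rightarrow> ('a \<Rightarrow> real) \<Rightarrow> real) \<Rightarrow> ('a \<Rightarrow> real) set
     \<Rightarrow> (real \<Rightarrow> ('a \<Rightarrow> real) \<Rightarrow> 'a \<Rightarrow> real) \<Rightarrow> bool" where
  "heat_semigroup M E F P \<longleftrightarrow>
     (\<forall>s\<ge>0. \<forall>t\<ge>0. \<forall>f\<in>Lp_fun M 2. AE x in M. P (s + t) f x = P s (P t f) x) \<and>
     (\<forall>t\<ge>0. \<forall>f\<in>Lp_fun M 2. \<forall>g\<in>Lp_fun M 2. L2_inner M (P t f) g = L2_inner M f (P t g)) \<and>
     (\<forall>f\<in>Lp_fun M 2. ((\<lambda>t. Lp_norm M 2 (\<lambda>x. P t f x - f x)) \<longlongrightarrow> 0) (at_right 0)) \<and>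
     (\<forall>f\<in>Lp_fun M 2. \<forall>h\<in>Lp_fun M 2.
        ((\<lambda>t. Lp_norm M 2 (\<lambda>x. (P t f x - f x) / t - h x)) \<longlongrightarrow> 0) (at_right 0) \<longleftrightarrow>
        f \<in> F \<and> (\<forall>g\<in>F. E f g = - L2_inner M h g))"

definition Lp_contractions :: "'a measure \<Rightarrow> (real \<Rightarrow> ('a \<Rightarrow> real) \<Rightarrow> 'a \<Rightarrow> real) \<Rightarrow> bool" where
  "Lp_contractions M P \<longleftrightarrow>
     (\<forall>q\<ge>1. \<forall>t\<ge>0. \<forall>f\<in>Lp_fun M q.
        P t f \<in> Lp_fun M q \<and> Lp_norm M q (P t f) \<le> Lp_norm M q f \<and>
        (AE x in M. P 0 f x = f x) \<and>
        (\<forall>g\<in>Lp_fun M q.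
           ((AE x in M. f x = g x) \<longrightarrow> (AE x in M. P t f x = P t g x)) \<and>
           (\<forall>a b. AE x in M. P t (\<lambda>y. a * f y + b * g y) x = a * P t f x + b * P t g x)))"

text \<open>\<open>k t x y\<close> stands for \<open>p\<^sub>t(x, y)\<close>. Requiring the kernel representation on every \<open>L\<^sup>q\<close>, and not
  only on \<open>L\<^sup>2\<close>, also pins down the extension of the semigroup from \<open>L\<^sup>2\<close> to \<open>L\<^sup>q\<close>.\<close>

definition heat_kernel ::
  "'a measure \<Rightarrow> (real \<Rightarrow> ('a \<Rightarrow> real) \<Rightarrow> 'a \<Rightarrow> real) \<Rightarrow> (real \<Rightarrow> 'a \<Rightarrow> 'a \<Rightarrow> real) \<Rightarrow> bool" where
  "heat_kernel M P k \<longleftrightarrow>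
     (\<forall>t>0. (\<lambda>(x, y). k t x y) \<in> borel_measurable (M \<Otimes>\<^sub>M M) \<and>
        (\<forall>x\<in>space M. \<forall>y\<in>space M. 0 \<le> k t x y) \<and>
        (\<forall>q\<ge>1. \<forall>f\<in>Lp_fun M q. AE x in M.
           integrable M (\<lambda>y. k t x y * f y) \<and> P t f x = (LINT y|M. k t x y * f y)))"

locale heat_dirichlet_space = dirichlet_space M E F
  for M :: "'a measure"
    and E :: "('a \<Rightarrow> real) \<Rightarrow> ('a \<Rightarrow> real) \<Rightarrow> real"
    and F :: "('a \<Rightarrow> real) set" +
  fixes P :: "real \<Rightarrow> ('a \<Rightarrow> real) \<Rightarrow> 'a \<Rightarrow> real"
    and k :: "real \<Rightarrow> 'a \<Rightarrow> 'a \<Rightarrow> real"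
  assumes semigroup: "heat_semigroup M E F P"
    and contractions: "Lp_contractions M P"
    and kernel: "heat_kernel M P k"
    and conservative: "\<And>t. 0 \<le> t \<Longrightarrow> AE x in M. P t (\<lambda>_. 1) x = 1"

text \<open>\<open>P\<^sub>t g\<close> for a nonnegative measurable \<open>g\<close>, via the kernel. For fixed \<open>y\<close> the function
  \<open>x \<mapsto> |f(x) - f(y)|\<^sup>p\<close> need not lie in any \<open>L\<^sup>q\<close>, and it is evaluated at the point \<open>y\<close> itself.\<close>

definition heat_nonneg ::
  "'a measure \<Rightarrow> (real \<Rightarrow> 'a \<Rightarrow> 'a \<Rightarrow> real) \<Rightarrow> real \<Rightarrow> ('a \<Rightarrow> ennreal) \<Rightarrow> 'a \<Rightarrow> ennreal" where
  "heat_nonneg M k t g y = (\<integral>\<^sup>+x. ennreal (k t y x) * g x \<partial>M)"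

definition besov_quotient ::
  "'a measure \<Rightarrow> (real \<Rightarrow> 'a \<Rightarrow> 'a \<Rightarrow> real) \<Rightarrow> real \<Rightarrow> real \<Rightarrow> ('a \<Rightarrow> real) \<Rightarrow> real \<Rightarrow> ennreal" where
  "besov_quotient M k p \<alpha> f t =
     ennreal (t powr (- \<alpha>)) *
     epowr (\<integral>\<^sup>+y. heat_nonneg M k t (\<lambda>x. ennreal (\<bar>f x - f y\<bar> powr p)) y \<partial>M) (1 / p)"

definition besov ::
  "'a measure \<Rightarrow> (real \<Rightarrow> 'a \<Rightarrow> 'a \<Rightarrow> real) \<Rightarrow> real \<Rightarrow> real \<Rightarrow> ('a \<Rightarrow> real) set" where
  "besov M k p \<alpha> =
     {f \<in> Lp_fun M (ennreal p). Limsup (at_right 0) (besov_quotient M k p \<alpha> f) < \<top>}"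

definition nontrivial_exponents ::
  "'a measure \<Rightarrow> (real \<Rightarrow> 'a \<Rightarrow> 'a \<Rightarrow> real) \<Rightarrow> real \<Rightarrow> real set" where
  "nontrivial_exponents M k p =
     {\<alpha>. 0 < \<alpha> \<and> (\<exists>f\<in>besov M k p \<alpha>. \<not> (\<exists>c. AE x in M. f x = c))}"

text \<open>The supremum is a finite positive number iff the set is nonempty and bounded above;
  otherwise this real number is meaningless.\<close>

definition critical_exponent ::
  "'a measure \<Rightarrow> (real \<Rightarrow> 'a \<Rightarrow> 'a \<Rightarrow> real) \<Rightarrow> real \<Rightarrow> real" where
  "critical_exponent M k p = Sup (nontrivial_exponents M k p)"

text \<open>\<open>W\<^sup>1\<^sup>,\<^sup>p(E)\<close> for \<open>p > 1\<close>, and \<open>BV(E)\<close> for \<open>p = 1\<close>.\<close>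

definition sobolev_BV ::
  "'a measure \<Rightarrow> (real \<Rightarrow> 'a \<Rightarrow> 'a \<Rightarrow> real) \<Rightarrow> real \<Rightarrow> ('a \<Rightarrow> real) set" where
  "sobolev_BV M k p = besov M k p (critical_exponent M k p)"

definition Var ::
  "'a measure \<Rightarrow> (real \<Rightarrow> 'a \<Rightarrow> 'a \<Rightarrow> real) \<Rightarrow> real \<Rightarrow> ('a \<Rightarrow> real) \<Rightarrow> ennreal" where
  "Var M k p f = Liminf (at_right 0) (besov_quotient M k p (critical_exponent M k p) f)"

definition PPI ::
  "'a measure \<Rightarrow> (real \<Rightarrow> ('a \<Rightarrow> real) \<Rightarrow> 'a \<Rightarrow> real) \<Rightarrow> (real \<Rightarrow> 'a \<Rightarrow> 'a \<Rightarrow> real) \<Rightarrow> real \<Rightarrow> bool" where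
  "PPI M P k p \<longleftrightarrow>
     (\<exists>C>0. \<forall>t\<ge>0. \<forall>f\<in>sobolev_BV M k p.
        Lp_norm M (ennreal p) (\<lambda>x. P t f x - f x)
          \<le> ennreal (C * t powr critical_exponent M k p) * Var M k p f)"

end

theory Submission
  imports Defs
begin

text \<open>
  Write \<open>\<alpha>\<close> for the critical exponent, \<open>V = Var f\<close>, \<open>d = p \<alpha> / \<beta> < 1\<close> and \<open>1/q = 1/p - \<alpha>/\<beta>\<close>, that is,
  \<open>q (1 - d) = p\<close>. The whole scale of inequalities follows from its endpoint \<open>\<theta> = 1\<close>, the Sobolev
  inequality \<open>\<parallel>f\<parallel>\<^sub>q \<le> C V\<close>: since \<open>1/r = \<theta>/q + (1 - \<theta>)/s\<close>, interpolation of \<open>L\<^sup>r\<close> between \<open>L\<^sup>q\<close>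
  and \<open>L\<^sup>s\<close> (\<open>Lp_norm_interpolation\<close>) gives \<open>\<parallel>f\<parallel>\<^sub>r \<le> \<parallel>f\<parallel>\<^sub>q\<^sup>\<theta> \<parallel>f\<parallel>\<^sub>s\<^sup>1\<^sup>-\<^sup>\<theta>\<close>.

  The Sobolev inequality is proved by truncation. Cut the values of \<open>|f|\<close> at the dyadic levels
  \<open>2\<^sup>j\<close>, with \<open>j\<close> ranging over all integers, and let \<open>f\<^sub>j\<close> be the part of \<open>|f|\<close> between \<open>2\<^sup>j\<close> and \<open>2\<^sup>j\<^sup>+\<^sup>1\<close>.
  Three facts are combined.

  (1) The increments of the slices \<open>f\<^sub>j\<close> use disjoint parts of the increment of \<open>|f|\<close>, so
  \<open>\<Sum>\<^sub>j |f\<^sub>j(x) - f\<^sub>j(y)|\<^sup>p \<le> |f(x) - f(y)|\<^sup>p\<close> when \<open>p \<ge> 1\<close>. Integrating against the kernel and using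
  that a lower limit is superadditive gives \<open>\<Sum>\<^sub>j (Var f\<^sub>j)\<^sup>p \<le> V\<^sup>p\<close> (\<open>sum_Var_slice_le\<close>).

  (2) Let \<open>m\<^sub>j = \<mu>(|f| > 2\<^sup>j)\<close>, which is finite because \<open>f\<close> is in \<open>L\<^sup>p\<close>. The slice \<open>f\<^sub>j\<close> has
  \<open>L\<^sup>1\<close>-norm at most \<open>2\<^sup>j m\<^sub>j\<close>, so the kernel bound makes \<open>P\<^sub>t f\<^sub>j \<le> 2\<^sup>j\<^sup>-\<^sup>1\<close> once \<open>t\<^sup>\<beta> = 2 C\<^sub>h m\<^sub>j\<close>. On
  \<open>{|f| > 2\<^sup>j\<^sup>+\<^sup>1}\<close> the slice equals \<open>2\<^sup>j\<close>, hence differs from \<open>P\<^sub>t f\<^sub>j\<close> by at least \<open>2\<^sup>j\<^sup>-\<^sup>1\<close> there, and the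
  pseudo-Poincare inequality at this time \<open>t\<close> bounds the measure of that set:
  \<open>2\<^sup>j\<^sup>p m\<^sub>j\<^sub>+\<^sub>1 \<le> const m\<^sub>j\<^sup>d (Var f\<^sub>j)\<^sup>p\<close> (\<open>slice_superlevel_bound\<close>).

  (3) In terms of \<open>b\<^sub>j = 2\<^sup>j\<^sup>q m\<^sub>j\<close> this reads \<open>b\<^sub>j\<^sub>+\<^sub>1 \<le> K b\<^sub>j\<^sup>d (Var f\<^sub>j)\<^sup>p\<close>, the powers of \<open>2\<close> cancelling
  exactly because \<open>q d = q - p\<close>. As \<open>d < 1\<close>, the recursion bounds the supremum of \<open>b\<close>
  by a power of \<open>V\<close>; inserting that bound once more and summing with (1) bounds \<open>\<Sum>\<^sub>j b\<^sub>j\<close>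
  (\<open>recursion_sum_bound\<close>), which is comparable to the integral of \<open>|f|\<^sup>q\<close>.
\<close>

section \<open>Powers of extended nonnegative reals and lower limits\<close>

lemma epowr_ennreal: "0 \<le> x \<Longrightarrow> 0 < a \<Longrightarrow> epowr (ennreal x) a = ennreal (x powr a)"
  by (simp add: epowr_def)

lemma epowr_top: "0 < a \<Longrightarrow> epowr \<top> a = \<top>"
  by (simp add: epowr_def)

lemma epowr_zero: "0 < a \<Longrightarrow> epowr 0 a = 0"
  by (simp add: epowr_def)

lemma epowr_0_right: "epowr x 0 = 1"
  by (simp add: epowr_def)

lemma epowr_1_right: "epowr x 1 = x"
  by (cases x) (simp_all add: epowr_def)

lemma epowr_eq_0_iff: "0 < a \<Longrightarrow> epowr x a = 0 \<longleftrightarrow> x = 0"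
  by (cases x) (auto simp: epowr_ennreal epowr_top)

lemma epowr_eq_top_iff: "0 < a \<Longrightarrow> epowr x a = \<top> \<longleftrightarrow> x = \<top>"
  by (cases x) (auto simp: epowr_ennreal epowr_top)

lemma epowr_mono: "0 \<le> a \<Longrightarrow> x \<le> y \<Longrightarrow> epowr x a \<le> epowr y a"
  by (cases "a = 0"; cases x; cases y)
     (auto simp: epowr_ennreal epowr_top epowr_0_right top_unique intro!: ennreal_leI powr_mono2)

lemma epowr_epowr: "0 < a \<Longrightarrow> 0 < b \<Longrightarrow> epowr (epowr x a) b = epowr x (a * b)"
  by (cases x) (auto simp: epowr_ennreal epowr_top powr_powr)

lemma epowr_mult: "0 \<le> a \<Longrightarrow> epowr (x * y) a = epowr x a * epowr y a"
  by (cases "a = 0"; cases "x = 0"; cases "y = 0"; cases x; cases y)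
     (auto simp: epowr_ennreal epowr_top epowr_0_right epowr_zero powr_mult ennreal_mult[symmetric]
        ennreal_mult_top ennreal_top_mult)

lemma epowr_le_iff:
  assumes "0 < a" shows "epowr x a \<le> epowr y a \<longleftrightarrow> x \<le> y"
proof
  assume "epowr x a \<le> epowr y a"
  from epowr_mono[OF _ this, of "1/a"] assms show "x \<le> y"
    by (simp add: epowr_epowr epowr_1_right)
qed (use assms epowr_mono in auto)

text \<open>Raising to a positive power is an order isomorphism of \<open>[0, \<infinity>]\<close>, so it transports strict lower
  bounds in both directions, and a lower limit is determined by its strict lower bounds.\<close>

lemma epowr_Liminf_le:
  assumes "0 < a"
  shows "epowr (Liminf G g) a \<le> Liminf G (\<lambda>t. epowr (g t) a)"
  unfolding le_Liminf_iff
proof safe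
  fix y assume y: "y < epowr (Liminf G g) a"
  have inv: "epowr (epowr z (1/a)) a = z" for z
    using assms by (simp add: epowr_epowr epowr_1_right)
  have "epowr y (1/a) < Liminf G g"
    using y assms epowr_le_iff[of a "Liminf G g" "epowr y (1/a)"] by (simp add: inv not_le[symmetric])
  then have "eventually (\<lambda>t. epowr y (1/a) < g t) G"
    using le_Liminf_iff[of "Liminf G g" G g] by auto
  then show "eventually (\<lambda>t. y < epowr (g t) a) G"
    by eventually_elim (use assms epowr_le_iff inv not_le in metis)
qed

lemma epowr_Liminf:
  assumes "0 < a"
  shows "epowr (Liminf G g) a = Liminf G (\<lambda>t. epowr (g t) a)"
proof (rule antisym[OF epowr_Liminf_le[OF assms]])
  have "epowr (Liminf G (\<lambda>t. epowr (g t) a)) (1/a) \<le> Liminf G (\<lambda>t. epowr (epowr (g t) a) (1/a))"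
    using assms by (intro epowr_Liminf_le) auto
  also have "\<dots> = epowr (epowr (Liminf G g) a) (1/a)"
    using assms by (simp add: epowr_epowr epowr_1_right)
  finally show "Liminf G (\<lambda>t. epowr (g t) a) \<le> epowr (Liminf G g) a"
    using assms by (subst (asm) epowr_le_iff) auto
qed

text \<open>The proof writes both lower limits as suprema of infima over large sets and restricts each pair of
  such sets to its intersection, which is again large.\<close>

lemma Liminf_add_le_ennreal:
  fixes f g :: "'b \<Rightarrow> ennreal"
  shows "Liminf G f + Liminf G g \<le> Liminf G (\<lambda>t. f t + g t)"
proof -
  let ?S = "{P. eventually P G}"
  have ne: "?S \<noteq> {}" using eventually_True by blast
  have "Liminf G f + Liminf G g = (SUP P\<in>?S. (INF t\<in>Collect P. f t) + Liminf G g)"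
    unfolding Liminf_def[of G f] by (rule ennreal_SUP_add_left[OF ne, symmetric])
  also have "\<dots> \<le> Liminf G (\<lambda>t. f t + g t)"
  proof (rule SUP_least)
    fix P assume P: "P \<in> ?S"
    have "(INF t\<in>Collect P. f t) + Liminf G g
        = (SUP Q\<in>?S. (INF t\<in>Collect P. f t) + (INF t\<in>Collect Q. g t))"
      unfolding Liminf_def[of G g] by (rule ennreal_SUP_add_right[OF ne])
    also have "\<dots> \<le> Liminf G (\<lambda>t. f t + g t)"
    proof (rule SUP_least)
      fix Q assume Q: "Q \<in> ?S"
      have "eventually (\<lambda>t. P t \<and> Q t) G" using P Q by (auto intro: eventually_conj)
      then have "(INF t\<in>{t. P t \<and> Q t}. f t + g t) \<le> Liminf G (\<lambda>t. f t + g t)"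
        unfolding Liminf_def by (intro SUP_upper) auto
      moreover have "(INF t\<in>Collect P. f t) + (INF t\<in>Collect Q. g t) \<le> (INF t\<in>{t. P t \<and> Q t}. f t + g t)"
        by (intro INF_greatest add_mono INF_lower) auto
      ultimately show "(INF t\<in>Collect P. f t) + (INF t\<in>Collect Q. g t) \<le> Liminf G (\<lambda>t. f t + g t)"
        by order
    qed
    finally show "(INF t\<in>Collect P. f t) + Liminf G g \<le> Liminf G (\<lambda>t. f t + g t)" .
  qed
  finally show ?thesis .
qed

lemma Liminf_sum_le_ennreal:
  fixes g :: "'i \<Rightarrow> 'b \<Rightarrow> ennreal"
  assumes "finite I"
  shows "(\<Sum>i\<in>I. Liminf G (g i)) \<le> Liminf G (\<lambda>t. \<Sum>i\<in>I. g i t)"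
  using assms
proof (induction I rule: finite_induct)
  case (insert i I)
  then have "(\<Sum>j\<in>insert i I. Liminf G (g j)) \<le> Liminf G (g i) + Liminf G (\<lambda>t. \<Sum>j\<in>I. g j t)"
    by (simp add: add_left_mono)
  also have "\<dots> \<le> Liminf G (\<lambda>t. g i t + (\<Sum>j\<in>I. g j t))"
    by (rule Liminf_add_le_ennreal)
  finally show ?case using insert by simp
qed simp

section \<open>Slicing a function at dyadic levels\<close>

text \<open>The part of \<open>|u|\<close> lying in the band \<open>[2\<^sup>k, 2\<^sup>k\<^sup>+\<^sup>1]\<close>, shifted down to start at \<open>0\<close>. The band
  has height \<open>2\<^sup>k\<close>, so this value is also the cap. Taking \<open>|u|\<close> here makes the slices of a signed
  function nonnegative at once.\<close>

definition dyadic_slice :: "int \<Rightarrow> real \<Rightarrow> real" where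
  "dyadic_slice k u = min (max 0 (\<bar>u\<bar> - 2 powr k)) (2 powr k)"

lemma dyadic_slice_nonneg: "0 \<le> dyadic_slice k u"
  by (simp add: dyadic_slice_def)

lemma dyadic_slice_le: "dyadic_slice k u \<le> \<bar>u\<bar>"
  by (simp add: dyadic_slice_def min_def max_def)

lemma two_powr_int_Suc: "(2::real) powr (real_of_int (k + 1)) = 2 * 2 powr k"
  by (simp add: powr_add)

text \<open>The sum telescopes: consecutive bands stack up to the clamping of \<open>|u|\<close> to \<open>[2\<^sup>a, 2\<^sup>a\<^sup>+\<^sup>n]\<close>.\<close>

lemma sum_dyadic_slice_interval:
  "(\<Sum>k\<in>{a..<a + int n}. dyadic_slice k u) = min (max \<bar>u\<bar> (2 powr a)) (2 powr (a + int n)) - 2 powr a"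
proof (induction n)
  case (Suc n)
  have "{a..<a + int (Suc n)} = insert (a + int n) {a..<a + int n}" by auto
  then have "(\<Sum>k\<in>{a..<a + int (Suc n)}. dyadic_slice k u)
      = dyadic_slice (a + int n) u + (min (max \<bar>u\<bar> (2 powr a)) (2 powr (a + int n)) - 2 powr a)"
    using Suc by simp
  moreover have "(2::real) powr (a + int (Suc n)) = 2 * 2 powr (a + int n)"
    using two_powr_int_Suc[of "a + int n"] by (simp add: add_ac)
  moreover have "(2::real) powr a \<le> 2 powr (a + int n)" "0 < (2::real) powr (a + int n)" by simp_all
  ultimately show ?case unfolding dyadic_slice_def by linarith
qed simp

text \<open>Every slice is monotone in \<open>|u|\<close>, so all differences have the same sign and the sum over a full
  interval of indices containing \<open>I\<close> telescopes to a difference of two clamped values; clamping is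
  a contraction.\<close>

lemma sum_dyadic_slice_diff_le:
  assumes "finite I"
  shows "(\<Sum>k\<in>I. \<bar>dyadic_slice k u - dyadic_slice k v\<bar>) \<le> \<bar>u - v\<bar>"
proof -
  have main: "(\<Sum>k\<in>I. \<bar>dyadic_slice k u - dyadic_slice k v\<bar>) \<le> \<bar>u\<bar> - \<bar>v\<bar>" if "\<bar>v\<bar> \<le> \<bar>u\<bar>" for u v
  proof -
    obtain N where N: "\<And>k. k \<in> I \<Longrightarrow> \<bar>k\<bar> < int N"
    proof -
      have "finite (abs ` I)" using assms by simp
      then obtain m where "\<forall>x\<in>abs ` I. x \<le> m" using bdd_above_finite unfolding bdd_above_def by blast
      then show ?thesis by (intro that[of "nat (m + 1)"]) force
    qed
    let ?J = "{- int N..<- int N + int (2 * N)}"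
    have mono: "dyadic_slice k v \<le> dyadic_slice k u" for k
      using that by (auto simp: dyadic_slice_def)
    have "(\<Sum>k\<in>I. \<bar>dyadic_slice k u - dyadic_slice k v\<bar>)
        \<le> (\<Sum>k\<in>?J. \<bar>dyadic_slice k u - dyadic_slice k v\<bar>)"
    proof (rule sum_mono2)
      show "I \<subseteq> ?J" using N by (force simp: abs_less_iff)
    qed auto
    also have "\<dots> = (\<Sum>k\<in>?J. dyadic_slice k u) - (\<Sum>k\<in>?J. dyadic_slice k v)"
      using mono by (simp add: sum_subtractf[symmetric])
    also have "\<dots> \<le> \<bar>u\<bar> - \<bar>v\<bar>"
      unfolding sum_dyadic_slice_interval using that by (simp add: min_def max_def)
    finally show ?thesis .
  qed
  show ?thesis
  proof (cases "\<bar>v\<bar> \<le> \<bar>u\<bar>")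
    case True with main[OF True] show ?thesis by linarith
  next
    case False
    then have "\<bar>u\<bar> \<le> \<bar>v\<bar>" by simp
    from main[OF this] show ?thesis by (simp add: abs_minus_commute)
  qed
qed

lemma sum_powr_le_powr_sum:
  fixes d :: "'i \<Rightarrow> real"
  assumes "finite I" "\<And>i. i \<in> I \<Longrightarrow> 0 \<le> d i" "1 \<le> p"
  shows "(\<Sum>i\<in>I. d i powr p) \<le> (\<Sum>i\<in>I. d i) powr p"
proof -
  let ?S = "\<Sum>i\<in>I. d i"
  have split: "x powr p = x * x powr (p - 1)" if "0 \<le> x" for x :: real
    using that assms(3) powr_add[of x 1 "p - 1"] by (cases "x = 0") auto
  have S: "0 \<le> ?S" using assms by (intro sum_nonneg) auto
  have "(\<Sum>i\<in>I. d i powr p) = (\<Sum>i\<in>I. d i * d i powr (p - 1))"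
    using assms by (intro sum.cong refl split) auto
  also have "\<dots> \<le> (\<Sum>i\<in>I. d i * ?S powr (p - 1))"
    using assms by (intro sum_mono mult_left_mono powr_mono2 member_le_sum) auto
  also have "\<dots> = ?S powr p"
    using split[OF S] by (simp add: sum_distrib_right)
  finally show ?thesis .
qed

lemma sum_dyadic_slice_diff_powr_le:
  assumes "finite I" "1 \<le> p"
  shows "(\<Sum>k\<in>I. \<bar>dyadic_slice k u - dyadic_slice k v\<bar> powr p) \<le> \<bar>u - v\<bar> powr p"
proof -
  have "(\<Sum>k\<in>I. \<bar>dyadic_slice k u - dyadic_slice k v\<bar> powr p)
      \<le> (\<Sum>k\<in>I. \<bar>dyadic_slice k u - dyadic_slice k v\<bar>) powr p"
    using assms by (intro sum_powr_le_powr_sum) auto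
  also have "\<dots> \<le> \<bar>u - v\<bar> powr p"
    using assms by (intro powr_mono2 sum_dyadic_slice_diff_le sum_nonneg) auto
  finally show ?thesis .
qed

section \<open>A sublinear recursion on a two-sided sequence\<close>

text \<open>Dividing the hypothesis by \<open>x\<^sup>d\<close> leaves \<open>x\<^sup>1\<^sup>-\<^sup>d \<le> y\<close>.\<close>

lemma powr_absorb:
  fixes x y :: real
  assumes "0 \<le> x" "0 \<le> y" "d < 1" "x \<le> x powr d * y"
  shows "x \<le> y powr (1 / (1 - d))"
proof (cases "x = 0")
  case False
  with assms have x: "0 < x" by simp
  have "x powr (1 - d) = x / x powr d" using x by (simp add: powr_diff)
  also have "\<dots> \<le> y" using assms x by (simp add: divide_le_eq mult.commute)
  finally have "(x powr (1 - d)) powr (1 / (1 - d)) \<le> y powr (1 / (1 - d))"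
    using assms x by (intro powr_mono2) auto
  then show ?thesis using assms x by (simp add: powr_powr)
qed simp

text \<open>Because \<open>v\<close> is bounded by \<open>W\<close>, the supremum \<open>S\<close> of \<open>b\<close> over indices up to \<open>N\<close> satisfies
  \<open>S \<le> S\<^sup>d K W\<close>: the recursion only looks downwards, so the half line of indices is stable
  under it. Absorption bounds \<open>S\<close> independently of \<open>N\<close>. Inserting this uniform bound into the
  recursion leaves a constant times \<open>v\<close>, which is summable. Absorption requires \<open>S\<close>
  to be finite, which is why \<open>b\<close> has to be bounded on each half line beforehand.\<close>

lemma recursion_sum_bound:
  fixes b v :: "int \<Rightarrow> real"
  assumes d: "0 \<le> d" "d < 1" and K: "0 \<le> K"
    and b: "\<And>k. 0 \<le> b k" and v: "\<And>k. 0 \<le> v k"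
    and rec: "\<And>k. b (k + 1) \<le> K * b k powr d * v k"
    and bdd: "\<And>N. bdd_above (b ` {..N})"
    and W: "\<And>I. finite I \<Longrightarrow> sum v I \<le> W"
    and "finite I"
  shows "sum b I \<le> (K * W) powr (1 / (1 - d))"
proof -
  have W0: "0 \<le> W" using W[of "{}"] by simp
  have vW: "v k \<le> W" for k using W[of "{k}"] by simp
  have rec': "b k \<le> K * b (k - 1) powr d * v (k - 1)" for k using rec[of "k - 1"] by simp
  define B where "B = (K * W) powr (1 / (1 - d))"
  have bB: "b N \<le> B" for N
  proof -
    define S where "S = Sup (b ` {..N})"
    have le: "b k \<le> S" if "k \<le> N" for k
      unfolding S_def using that bdd by (intro cSUP_upper) auto
    have S0: "0 \<le> S" using le[of N] b[of N] by simp
    have "S \<le> S powr d * (K * W)"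
      unfolding S_def
    proof (rule cSUP_least, simp, unfold S_def[symmetric])
      fix k assume k: "k \<in> {..N}"
      have "b k \<le> K * b (k - 1) powr d * v (k - 1)" by (rule rec')
      also have "\<dots> \<le> K * S powr d * W"
        using k K d b v vW S0 W0 by (intro mult_mono powr_mono2 le) auto
      finally show "b k \<le> S powr d * (K * W)" by (simp add: mult_ac)
    qed
    then have "S \<le> B" unfolding B_def using S0 K W0 d by (intro powr_absorb) auto
    then show ?thesis using le[of N] by simp
  qed
  have "sum b I \<le> (\<Sum>k\<in>I. K * B powr d * v (k - 1))"
  proof (rule sum_mono)
    fix k
    have "b k \<le> K * b (k - 1) powr d * v (k - 1)" by (rule rec')
    also have "\<dots> \<le> K * B powr d * v (k - 1)"
      using K d b v bB by (intro mult_mono powr_mono2) auto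
    finally show "b k \<le> K * B powr d * v (k - 1)" .
  qed
  also have "\<dots> = K * B powr d * sum v ((\<lambda>k. k - 1) ` I)"
    by (simp add: sum_distrib_left sum.reindex inj_on_def)
  also have "\<dots> \<le> K * B powr d * W"
    using K \<open>finite I\<close> by (intro mult_left_mono W) auto
  also have "\<dots> = B"
  proof (cases "K * W = 0")
    case False
    then have "0 < K * W" using K W0 by (simp add: order_less_le)
    then have "K * W * (K * W) powr (1 / (1 - d) * d) = (K * W) powr (1 + 1 / (1 - d) * d)"
      by (simp add: powr_add)
    moreover have "1 + 1 / (1 - d) * d = 1 / (1 - d)" using d by (simp add: field_simps)
    ultimately show ?thesis by (simp add: B_def powr_powr mult_ac)
  qed (auto simp: B_def)
  finally show ?thesis by (simp add: B_def)
qed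

section \<open>Lebesgue norms: interpolation and layers\<close>

lemma Lp_norm_ennreal:
  "0 \<le> q \<Longrightarrow> Lp_norm M (ennreal q) f = epowr (\<integral>\<^sup>+x. ennreal (\<bar>f x\<bar> powr q) \<partial>M) (1 / q)"
  by (simp add: Lp_norm_def)

lemma Lp_norm_less_top_iff:
  "0 < q \<Longrightarrow> Lp_norm M (ennreal q) f < \<top> \<longleftrightarrow> (\<integral>\<^sup>+x. ennreal (\<bar>f x\<bar> powr q) \<partial>M) < \<top>"
  by (simp add: Lp_norm_ennreal epowr_eq_top_iff less_top[symmetric])

lemma nn_integral_powr_eq_0_iff:
  fixes f :: "'a \<Rightarrow> real"
  assumes "f \<in> borel_measurable M" "0 < q"
  shows "(\<integral>\<^sup>+x. ennreal (\<bar>f x\<bar> powr q) \<partial>M) = 0 \<longleftrightarrow> (AE x in M. f x = 0)"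
  using assms by (subst nn_integral_0_iff_AE) auto

lemma Lp_norm_eq_0_iff:
  assumes "f \<in> borel_measurable M" "1 \<le> q"
  shows "Lp_norm M q f = 0 \<longleftrightarrow> (AE x in M. f x = 0)"
proof (cases q)
  case (real a)
  with assms have "1 \<le> a" by simp
  with real assms show ?thesis
    by (simp add: Lp_norm_ennreal epowr_eq_0_iff nn_integral_powr_eq_0_iff)
next
  case top
  have "(AE x in M. f x = 0)" if "esssup M (\<lambda>x. ennreal \<bar>f x\<bar>) = 0"
    using esssup_AE[of "\<lambda>x. ennreal \<bar>f x\<bar>" M] unfolding that by auto
  moreover have "esssup M (\<lambda>x. ennreal \<bar>f x\<bar>) \<le> 0" if "AE x in M. f x = 0"
    using assms that by (intro esssup_I) auto
  ultimately show ?thesis using top by (auto simp: Lp_norm_def)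
qed

text \<open>Hoelder's inequality with exponents \<open>1/l\<close> and \<open>1/(1 - l)\<close>, obtained by integrating Young's
  inequality for the normalised functions \<open>f/A\<close> and \<open>g/B\<close>.\<close>

lemma weighted_Hoelder:
  fixes f g :: "'a \<Rightarrow> real"
  assumes [measurable]: "f \<in> borel_measurable M" "g \<in> borel_measurable M"
    and nonneg: "\<And>x. 0 \<le> f x" "\<And>x. 0 \<le> g x"
    and l: "0 < l" "l < 1"
    and A: "(\<integral>\<^sup>+x. ennreal (f x) \<partial>M) = ennreal A" "0 < A"
    and B: "(\<integral>\<^sup>+x. ennreal (g x) \<partial>M) = ennreal B" "0 < B"
  shows "(\<integral>\<^sup>+x. ennreal (f x powr l * g x powr (1 - l)) \<partial>M) \<le> ennreal (A powr l * B powr (1 - l))"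
proof -
  let ?c = "A powr l * B powr (1 - l)"
  have pt: "f x powr l * g x powr (1 - l) \<le> ?c * l / A * f x + ?c * (1 - l) / B * g x" for x
  proof (cases "f x = 0 \<or> g x = 0")
    case False
    then have pos: "0 < f x" "0 < g x" using nonneg[of x] by auto
    have "f x powr l * g x powr (1 - l) = ?c * ((f x / A) powr l * (g x / B) powr (1 - l))"
      using pos A(2) B(2) by (simp add: powr_divide)
    also have "\<dots> \<le> ?c * (l * (f x / A) + (1 - l) * (g x / B))"
      using pos A(2) B(2) l by (intro mult_left_mono Youngs_inequality_0) auto
    finally show ?thesis by (simp add: algebra_simps)
  qed (use nonneg A B l in auto)
  have "(\<integral>\<^sup>+x. ennreal (f x powr l * g x powr (1 - l)) \<partial>M)
      \<le> (\<integral>\<^sup>+x. ennreal (?c * l / A) * ennreal (f x) + ennreal (?c * (1 - l) / B) * ennreal (g x) \<partial>M)"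
    using pt A(2) B(2) l nonneg
    by (intro nn_integral_mono) (simp add: ennreal_mult[symmetric] ennreal_plus[symmetric] del: ennreal_plus)
  also have "\<dots> = ennreal (?c * l / A) * ennreal A + ennreal (?c * (1 - l) / B) * ennreal B"
    by (simp add: nn_integral_add nn_integral_cmult A(1) B(1))
  also have "\<dots> = ennreal (?c * l + ?c * (1 - l))"
    using A(2) B(2) l by (simp add: ennreal_mult[symmetric] ennreal_plus[symmetric] del: ennreal_plus)
  also have "?c * l + ?c * (1 - l) = ?c" by (simp add: algebra_simps)
  finally show ?thesis .
qed

text \<open>For finite \<open>s\<close> this is Hoelder's inequality for \<open>|f|\<^sup>r = (|f|\<^sup>q)\<^sup>l (|f|\<^sup>s)\<^sup>1\<^sup>-\<^sup>l\<close> with \<open>l = r \<theta> / q\<close>; for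
  \<open>s = \<infinity>\<close> the surplus power \<open>r - q = r (1 - \<theta>)\<close> of \<open>|f|\<close> is bounded by the essential supremum.
  The exponent \<open>r\<close> is automatically finite. Since \<open>0 \<cdot> \<infinity> = 0\<close> on the right-hand side, the cases of
  infinite norms rely on a vanishing norm forcing \<open>f = 0\<close> almost everywhere.\<close>

lemma Lp_norm_interpolation:
  assumes [measurable]: "f \<in> borel_measurable M"
    and q: "1 \<le> q" and r: "1 \<le> r" and s: "1 \<le> s" and \<theta>: "0 < \<theta>" "\<theta> \<le> 1"
    and eq: "enn2real (1 / r) = \<theta> / q + (1 - \<theta>) * enn2real (1 / s)"
  shows "Lp_norm M r f \<le> epowr (Lp_norm M (ennreal q) f) \<theta> * epowr (Lp_norm M s f) (1 - \<theta>)"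
proof -
  have "0 < enn2real (1 / r)"
    unfolding eq using \<theta> q by (intro add_pos_nonneg) auto
  then obtain r' where r': "r = ennreal r'" "1 \<le> r'"
    using r by (cases r) auto
  have inv: "enn2real (1 / ennreal a) = 1 / a" if "1 \<le> a" for a
    using that by (simp add: divide_ennreal flip: ennreal_1)
  have eq': "1 / r' = \<theta> / q + (1 - \<theta>) * enn2real (1 / s)"
    using eq r' inv by simp
  show ?thesis
  proof (cases "AE x in M. f x = 0")
    case True
    then have "Lp_norm M r f = 0" using r by (subst Lp_norm_eq_0_iff) auto
    then show ?thesis by simp
  next
    case nz: False
    have n0: "Lp_norm M s f \<noteq> 0" "Lp_norm M (ennreal q) f \<noteq> 0"
      using nz s q by (auto simp: Lp_norm_eq_0_iff)
    consider "\<theta> = 1" | "\<theta> < 1" "Lp_norm M s f = \<top> \<or> Lp_norm M (ennreal q) f = \<top>"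
      | "\<theta> < 1" "Lp_norm M s f < \<top>" "Lp_norm M (ennreal q) f < \<top>"
      using \<theta>(2) unfolding less_top[symmetric] by argo
    then show ?thesis
    proof cases
      case 1
      then have "r' = q" using eq' q r' by simp
      then show ?thesis using r' 1 by (simp add: epowr_0_right epowr_1_right)
    next
      case 2
      then have "epowr (Lp_norm M (ennreal q) f) \<theta> * epowr (Lp_norm M s f) (1 - \<theta>) = \<top>"
        using n0 \<theta> by (auto simp: ennreal_mult_eq_top_iff epowr_eq_top_iff epowr_eq_0_iff)
      then show ?thesis by simp
    next
      case 3
      define A where "A = enn2real (\<integral>\<^sup>+x. ennreal (\<bar>f x\<bar> powr q) \<partial>M)"
      have "(\<integral>\<^sup>+x. ennreal (\<bar>f x\<bar> powr q) \<partial>M) < \<top>"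
        using 3(3) q by (simp add: Lp_norm_less_top_iff)
      then have A: "(\<integral>\<^sup>+x. ennreal (\<bar>f x\<bar> powr q) \<partial>M) = ennreal A" by (simp add: A_def)
      have A0: "0 < A" using A nz q nn_integral_powr_eq_0_iff[of f M q]
        by (auto simp: A_def enn2real_nonneg order_less_le)
      have nq: "Lp_norm M (ennreal q) f = ennreal (A powr (1 / q))"
        using q A A0 by (simp add: Lp_norm_ennreal epowr_ennreal)
      show ?thesis
      proof (cases s)
        case (real s')
        then have s': "1 \<le> s'" using s by simp
        define B where "B = enn2real (\<integral>\<^sup>+x. ennreal (\<bar>f x\<bar> powr s') \<partial>M)"
        have "(\<integral>\<^sup>+x. ennreal (\<bar>f x\<bar> powr s') \<partial>M) < \<top>"
          using 3(2) real s' by (simp add: Lp_norm_less_top_iff)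
        then have B: "(\<integral>\<^sup>+x. ennreal (\<bar>f x\<bar> powr s') \<partial>M) = ennreal B" by (simp add: B_def)
        have B0: "0 < B" using B nz s' nn_integral_powr_eq_0_iff[of f M s']
          by (auto simp: B_def enn2real_nonneg order_less_le)
        have ns: "Lp_norm M s f = ennreal (B powr (1 / s'))"
          using s' B B0 real by (simp add: Lp_norm_ennreal epowr_ennreal)
        define l where "l = r' * \<theta> / q"
        have "r' * (1 / r') = r' * (\<theta> / q + (1 - \<theta>) * (1 / s'))"
          using eq' real s' inv by simp
        then have l': "1 - l = r' * (1 - \<theta>) / s'"
          using r' by (simp add: l_def distrib_left)
        have "0 < 1 - l" unfolding l' using r' 3 s' by simp
        then have l: "0 < l" "l < 1" using r' \<theta> q by (simp_all add: l_def)
        have split: "\<bar>f x\<bar> powr r' = (\<bar>f x\<bar> powr q) powr l * (\<bar>f x\<bar> powr s') powr (1 - l)" for x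
        proof -
          have "q * l + s' * (1 - l) = r'" unfolding l' unfolding l_def using q s' by (simp add: field_simps)
          then show ?thesis by (simp add: powr_powr powr_add[symmetric])
        qed
        have "(\<integral>\<^sup>+x. ennreal (\<bar>f x\<bar> powr r') \<partial>M) \<le> ennreal (A powr l * B powr (1 - l))"
          unfolding split using A B A0 B0 l by (intro weighted_Hoelder) auto
        then have "Lp_norm M r f \<le> epowr (ennreal (A powr l * B powr (1 - l))) (1 / r')"
          using r' by (simp add: Lp_norm_ennreal epowr_mono)
        also have "\<dots> = ennreal (A powr (l / r') * B powr ((1 - l) / r'))"
          using r' by (simp add: epowr_ennreal powr_mult powr_powr)
        also have "\<dots> = epowr (Lp_norm M (ennreal q) f) \<theta> * epowr (Lp_norm M s f) (1 - \<theta>)"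
          unfolding nq ns l' unfolding l_def using \<theta> 3 r'
          by (simp add: epowr_ennreal powr_powr ennreal_mult mult.commute)
        finally show ?thesis .
      next
        case top
        define S where "S = enn2real (Lp_norm M s f)"
        have S: "Lp_norm M s f = ennreal S" using 3 by (simp add: S_def)
        have S0: "0 \<le> S" by (simp add: S_def)
        have "AE x in M. ennreal \<bar>f x\<bar> \<le> ennreal S"
          using esssup_AE[of "\<lambda>x. ennreal \<bar>f x\<bar>" M] S top by (simp add: Lp_norm_def)
        then have fS: "AE x in M. \<bar>f x\<bar> \<le> S" using S0 by simp
        have eqr: "q = r' * \<theta>" using eq' top r' q by (simp add: field_simps)
        have "(\<integral>\<^sup>+x. ennreal (\<bar>f x\<bar> powr r') \<partial>M)
            \<le> (\<integral>\<^sup>+x. ennreal (S powr (r' * (1 - \<theta>))) * ennreal (\<bar>f x\<bar> powr q) \<partial>M)"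
        proof (rule nn_integral_mono_AE, use fS in eventually_elim)
          fix x assume x: "\<bar>f x\<bar> \<le> S"
          have "\<bar>f x\<bar> powr r' = \<bar>f x\<bar> powr (r' * (1 - \<theta>)) * \<bar>f x\<bar> powr q"
            unfolding eqr by (simp add: powr_add[symmetric] algebra_simps)
          also have "\<dots> \<le> S powr (r' * (1 - \<theta>)) * \<bar>f x\<bar> powr q"
            using x r' \<theta> by (intro mult_right_mono powr_mono2) auto
          finally show "ennreal (\<bar>f x\<bar> powr r')
              \<le> ennreal (S powr (r' * (1 - \<theta>))) * ennreal (\<bar>f x\<bar> powr q)"
            by (simp add: ennreal_mult[symmetric])
        qed
        also have "\<dots> = ennreal (S powr (r' * (1 - \<theta>)) * A)"
          using A0 by (simp add: nn_integral_cmult A ennreal_mult)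
        finally have "Lp_norm M r f \<le> epowr (ennreal (S powr (r' * (1 - \<theta>)) * A)) (1 / r')"
          using r' by (simp add: Lp_norm_ennreal epowr_mono)
        also have "\<dots> = ennreal (S powr (1 - \<theta>) * A powr (1 / r'))"
          using r' A0 by (simp add: epowr_ennreal powr_mult powr_powr)
        also have "\<dots> = epowr (Lp_norm M (ennreal q) f) \<theta> * epowr (Lp_norm M s f) (1 - \<theta>)"
        proof -
          have "1 / r' = \<theta> / q" using eqr r' \<theta> by simp
          then show ?thesis
            unfolding nq S using \<theta> 3 r' S0
            by (simp add: epowr_ennreal powr_powr ennreal_mult mult.commute)
        qed
        finally show ?thesis .
      qed
    qed
  qed
qed

text \<open>At a point with \<open>2\<^sup>j < |f(x)| \<le> 2\<^sup>j\<^sup>+\<^sup>1\<close> the term of index \<open>j\<close> alone dominates \<open>|f(x)|\<^sup>q\<close> up to the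
  factor \<open>2\<^sup>q\<close>. Enumerating the integers turns the sum into an ordinary series, which may be integrated
  termwise.\<close>

lemma nn_integral_powr_le_dyadic_sum:
  fixes f :: "'a \<Rightarrow> real"
  assumes [measurable]: "f \<in> borel_measurable M" and q: "0 < q"
    and S: "\<And>I. finite I \<Longrightarrow>
      (\<Sum>j\<in>I. ennreal (2 powr (real_of_int j * q)) * emeasure M {x \<in> space M. 2 powr real_of_int j < \<bar>f x\<bar>}) \<le> S"
  shows "(\<integral>\<^sup>+x. ennreal (\<bar>f x\<bar> powr q) \<partial>M) \<le> ennreal (2 powr q) * S"
proof -
  define E where "E j = {x \<in> space M. 2 powr real_of_int j < \<bar>f x\<bar>}" for j
  define g :: "int \<Rightarrow> 'a \<Rightarrow> ennreal"
    where "g j x = ennreal (2 powr (real_of_int j * q)) * indicator (E j) x" for j x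
  have [measurable]: "E j \<in> sets M" for j unfolding E_def by measurable
  have [measurable]: "g j \<in> borel_measurable M" for j unfolding g_def by measurable
  have pt: "ennreal (\<bar>f x\<bar> powr q) \<le> ennreal (2 powr q) * (\<Sum>n. g (int_decode n) x)" if x: "x \<in> space M" for x
  proof (cases "f x = 0")
    case False
    \<comment> \<open>The ceiling minus one, rather than the floor, makes the lower inequality strict also when \<open>|f(x)|\<close> is a power of two.\<close>
    define j where "j = \<lceil>log 2 \<bar>f x\<bar>\<rceil> - 1"
    have fx: "2 powr (log 2 \<bar>f x\<bar>) = \<bar>f x\<bar>" using False by (simp add: powr_log_cancel)
    have "2 powr real_of_int j < 2 powr (log 2 \<bar>f x\<bar>)"
      unfolding j_def by (intro powr_less_mono) linarith+
    then have lo: "x \<in> E j" using x by (simp add: E_def fx)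
    have "2 powr (log 2 \<bar>f x\<bar>) \<le> 2 powr (real_of_int j + 1)"
      unfolding j_def by (intro powr_mono) linarith+
    then have "\<bar>f x\<bar> powr q \<le> (2 powr (real_of_int j + 1)) powr q"
      using q unfolding fx by (intro powr_mono2) auto
    also have "\<dots> = 2 powr q * 2 powr (real_of_int j * q)"
      by (simp add: powr_powr powr_add[symmetric] algebra_simps)
    finally have "ennreal (\<bar>f x\<bar> powr q) \<le> ennreal (2 powr q) * g j x"
      using lo by (simp add: g_def ennreal_mult[symmetric])
    also have "g j x = (\<Sum>n\<in>{int_encode j}. g (int_decode n) x)" by simp
    also have "\<dots> \<le> (\<Sum>n. g (int_decode n) x)"
      by (intro sum_le_suminf) auto
    finally show ?thesis by (simp add: mult_left_mono)
  qed (use q in simp)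
  have "(\<integral>\<^sup>+x. ennreal (\<bar>f x\<bar> powr q) \<partial>M)
      \<le> (\<integral>\<^sup>+x. ennreal (2 powr q) * (\<Sum>n. g (int_decode n) x) \<partial>M)"
    using pt by (rule nn_integral_mono)
  also have "\<dots> = ennreal (2 powr q) * (\<Sum>n. \<integral>\<^sup>+x. g (int_decode n) x \<partial>M)"
    by (simp add: nn_integral_cmult nn_integral_suminf)
  also have "(\<Sum>n. \<integral>\<^sup>+x. g (int_decode n) x \<partial>M) \<le> S"
  proof (rule suminf_le_const)
    fix N
    have "(\<Sum>n<N. \<integral>\<^sup>+x. g (int_decode n) x \<partial>M) = (\<Sum>j\<in>int_decode ` {..<N}. \<integral>\<^sup>+x. g j x \<partial>M)"
      by (simp add: sum.reindex inj_int_decode)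
    also have "\<dots> \<le> S"
      using S[of "int_decode ` {..<N}"] by (simp add: g_def nn_integral_cmult_indicator E_def)
    finally show "(\<Sum>n<N. \<integral>\<^sup>+x. g (int_decode n) x \<partial>M) \<le> S" .
  qed auto
  finally show ?thesis by (simp add: mult_left_mono)
qed

lemma Markov_powr:
  assumes [measurable]: "f \<in> borel_measurable M" and p: "0 < p" and l: "0 < l"
  shows "ennreal (l powr p) * emeasure M {x \<in> space M. l < \<bar>f x\<bar>} \<le> (\<integral>\<^sup>+x. ennreal (\<bar>f x\<bar> powr p) \<partial>M)"
proof -
  have "ennreal (l powr p) * emeasure M {x \<in> space M. l < \<bar>f x\<bar>}
      = (\<integral>\<^sup>+x. ennreal (l powr p) * indicator {x \<in> space M. l < \<bar>f x\<bar>} x \<partial>M)"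
    by (simp add: nn_integral_cmult_indicator)
  also have "\<dots> \<le> (\<integral>\<^sup>+x. ennreal (\<bar>f x\<bar> powr p) \<partial>M)"
    using l p by (intro nn_integral_mono) (auto simp: indicator_def intro!: ennreal_leI powr_mono2)
  finally show ?thesis .
qed

section \<open>Slices under the heat semigroup\<close>

context heat_dirichlet_space begin

lemma measurable_kernel: "0 < t \<Longrightarrow> (\<lambda>(x, y). k t x y) \<in> borel_measurable (M \<Otimes>\<^sub>M M)"
  using kernel by (simp add: heat_kernel_def)

lemma heat_eq_kernel_integral:
  "0 < t \<Longrightarrow> 1 \<le> q \<Longrightarrow> f \<in> Lp_fun M q \<Longrightarrow>
    AE x in M. integrable M (\<lambda>y. k t x y * f y) \<and> P t f x = (LINT y|M. k t x y * f y)"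
  using kernel by (auto simp: heat_kernel_def)

text \<open>A bounded kernel maps \<open>L\<^sup>1\<close> to \<open>L\<^sup>\<infinity>\<close>. Membership in some \<open>L\<^sup>q\<close> is what represents \<open>P\<^sub>t g\<close>
  by the kernel.\<close>

lemma heat_le_of_kernel_le:
  assumes t: "0 < t" and q: "1 \<le> q" "g \<in> Lp_fun M q" and g0: "\<And>x. 0 \<le> g x"
    and G: "(\<integral>\<^sup>+x. ennreal (g x) \<partial>M) \<le> ennreal G" "0 \<le> G"
    and B: "AE (x, y) in M \<Otimes>\<^sub>M M. k t x y \<le> B" "0 \<le> B"
  shows "AE x in M. P t g x \<le> B * G"
proof -
  interpret pair_sigma_finite M M ..
  have gm: "g \<in> borel_measurable M" using q by (simp add: Lp_fun_def)
  have gint: "integrable M g"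
    using gm g0 le_less_trans[OF G(1)] by (intro integrableI_nonneg) auto
  have "ennreal (LINT y|M. g y) \<le> ennreal G"
    using G nn_integral_eq_integral[OF gint] g0 by simp
  then have gG: "(LINT y|M. g y) \<le> G" using G(2) by simp
  have "AE x in M. AE y in M. k t x y \<le> B" using AE_pair[OF B(1)] by simp
  then show ?thesis
    using heat_eq_kernel_integral[OF t q]
  proof eventually_elim
    case (elim x)
    have "(LINT y|M. k t x y * g y) \<le> (LINT y|M. B * g y)"
      using elim gint g0
      by (intro integral_mono_AE) (auto elim!: eventually_mono intro: mult_right_mono)
    then have "P t g x \<le> (LINT y|M. B * g y)" using elim by simp
    also have "\<dots> \<le> B * G" using gG B by (simp add: mult_left_mono)
    finally show ?case .
  qed
qed

text \<open>Where \<open>g \<ge> 2 l\<close> while \<open>P\<^sub>t g \<le> l\<close>, the two differ by at least \<open>l\<close>, so this is Markov's inequality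
  for \<open>P\<^sub>t g - g\<close>.\<close>

lemma emeasure_superlevel_le:
  assumes t: "0 < t" and p: "1 \<le> p" and g: "g \<in> Lp_fun M (ennreal p)" "\<And>x. 0 \<le> g x"
    and l: "0 < l" and le: "AE x in M. P t g x \<le> l"
  shows "ennreal (l powr p) * emeasure M {x \<in> space M. 2 * l \<le> g x}
    \<le> epowr (Lp_norm M (ennreal p) (\<lambda>x. P t g x - g x)) p"
proof -
  have [measurable]: "g \<in> borel_measurable M" using g by (simp add: Lp_fun_def)
  have "ennreal (l powr p) * emeasure M {x \<in> space M. 2 * l \<le> g x}
      = (\<integral>\<^sup>+x. ennreal (l powr p) * indicator {x \<in> space M. 2 * l \<le> g x} x \<partial>M)"
    by (simp add: nn_integral_cmult_indicator)
  also have "\<dots> \<le> (\<integral>\<^sup>+x. ennreal (\<bar>P t g x - g x\<bar> powr p) \<partial>M)"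
    using le
    by (intro nn_integral_mono_AE, eventually_elim)
       (use l p in \<open>auto simp: indicator_def intro!: ennreal_leI powr_mono2\<close>)
  also have "\<dots> = epowr (Lp_norm M (ennreal p) (\<lambda>x. P t g x - g x)) p"
    using p by (simp add: Lp_norm_ennreal epowr_epowr epowr_1_right)
  finally show ?thesis .
qed

text \<open>The \<open>p\<close>-th power removes the outer root of the quotient, after which the pointwise inequality for
  increments of slices can be integrated against the kernel. It is used both for sums of variations
  and, with a single index, to keep slices in the same space.\<close>

lemma sum_besov_quotient_slice_le:
  assumes t: "0 < t" and p: "1 \<le> p" and [measurable]: "f \<in> borel_measurable M" and "finite I"
  shows "(\<Sum>j\<in>I. epowr (besov_quotient M k p \<alpha> (\<lambda>x. dyadic_slice j (f x)) t) p)
    \<le> epowr (besov_quotient M k p \<alpha> f t) p"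
proof -
  note [measurable] = measurable_kernel[OF t]
  have [measurable]: "(\<lambda>x. dyadic_slice j (f x)) \<in> borel_measurable M" for j
    unfolding dyadic_slice_def by measurable
  define D where "D g y = heat_nonneg M k t (\<lambda>x. ennreal (\<bar>g x - g y\<bar> powr p)) y" for g y
  define c where "c = epowr (ennreal (t powr (- \<alpha>))) p"
  have bq: "epowr (besov_quotient M k p \<alpha> g t) p = c * (\<integral>\<^sup>+y. D g y \<partial>M)" for g
    using p unfolding besov_quotient_def D_def c_def
    by (simp add: epowr_mult epowr_epowr epowr_1_right)
  have Dm: "D g \<in> borel_measurable M" if [measurable]: "g \<in> borel_measurable M" for g
    unfolding D_def heat_nonneg_def by measurable
  have "(\<Sum>j\<in>I. D (\<lambda>x. dyadic_slice j (f x)) y) \<le> D f y" if y: "y \<in> space M" for y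
  proof -
    have [measurable]: "(\<lambda>x. k t y x) \<in> borel_measurable M"
      using measurable_compose[OF measurable_Pair1'[OF y] measurable_kernel[OF t]] by simp
    have "(\<Sum>j\<in>I. D (\<lambda>x. dyadic_slice j (f x)) y)
        = (\<integral>\<^sup>+x. (\<Sum>j\<in>I. ennreal (k t y x) * ennreal (\<bar>dyadic_slice j (f x) - dyadic_slice j (f y)\<bar> powr p)) \<partial>M)"
      unfolding D_def heat_nonneg_def by (subst nn_integral_sum) auto
    also have "\<dots> \<le> (\<integral>\<^sup>+x. ennreal (k t y x) * ennreal (\<bar>f x - f y\<bar> powr p) \<partial>M)"
      using sum_dyadic_slice_diff_powr_le[OF \<open>finite I\<close> p]
      by (intro nn_integral_mono) (simp add: sum_distrib_left[symmetric] mult_left_mono)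
    finally show ?thesis unfolding D_def heat_nonneg_def .
  qed
  then have "(\<integral>\<^sup>+y. (\<Sum>j\<in>I. D (\<lambda>x. dyadic_slice j (f x)) y) \<partial>M) \<le> (\<integral>\<^sup>+y. D f y \<partial>M)"
    by (rule nn_integral_mono)
  then show ?thesis
    by (simp add: bq nn_integral_sum Dm sum_distrib_left[symmetric] mult_left_mono)
qed

text \<open>This is where it matters that the variation is a lower limit: lower limits are superadditive, so the
  inequality between quotients at each time passes to the limit.\<close>

lemma sum_Var_slice_le:
  assumes p: "1 \<le> p" and f: "f \<in> borel_measurable M" and I: "finite I"
  shows "(\<Sum>j\<in>I. epowr (Var M k p (\<lambda>x. dyadic_slice j (f x))) p) \<le> epowr (Var M k p f) p"
proof -
  let ?\<alpha> = "critical_exponent M k p"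
  let ?Q = "\<lambda>j. besov_quotient M k p ?\<alpha> (\<lambda>x. dyadic_slice j (f x))"
  have p0: "0 < p" using p by simp
  have "(\<Sum>j\<in>I. epowr (Var M k p (\<lambda>x. dyadic_slice j (f x))) p)
      \<le> Liminf (at_right 0) (\<lambda>t. \<Sum>j\<in>I. epowr (?Q j t) p)"
    unfolding Var_def epowr_Liminf[OF p0] by (rule Liminf_sum_le_ennreal[OF I])
  also have "\<dots> \<le> Liminf (at_right 0) (\<lambda>t. epowr (besov_quotient M k p ?\<alpha> f t) p)"
    using eventually_at_right_less[of "0::real"]
    by (intro Liminf_mono) (auto elim!: eventually_mono intro: sum_besov_quotient_slice_le[OF _ p f I])
  also have "\<dots> = epowr (Var M k p f) p"
    unfolding Var_def epowr_Liminf[OF p0] ..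
  finally show ?thesis .
qed

lemma slice_in_sobolev_BV:
  assumes p: "1 \<le> p" and f: "f \<in> sobolev_BV M k p"
  shows "(\<lambda>x. dyadic_slice j (f x)) \<in> sobolev_BV M k p"
proof -
  let ?g = "\<lambda>x. dyadic_slice j (f x)"
  let ?Q = "besov_quotient M k p (critical_exponent M k p)"
  have fm[measurable]: "f \<in> borel_measurable M"
    and fp: "Lp_norm M (ennreal p) f < \<top>" and lim: "Limsup (at_right 0) (?Q f) < \<top>"
    using f by (auto simp: sobolev_BV_def besov_def Lp_fun_def)
  have "?g \<in> borel_measurable M" unfolding dyadic_slice_def by measurable
  moreover have "Lp_norm M (ennreal p) ?g \<le> Lp_norm M (ennreal p) f"
    using p dyadic_slice_le dyadic_slice_nonneg
    by (auto simp: Lp_norm_ennreal intro!: epowr_mono nn_integral_mono ennreal_leI powr_mono2)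
  moreover have "Limsup (at_right 0) (?Q ?g) \<le> Limsup (at_right 0) (?Q f)"
  proof (rule Limsup_mono)
    have "?Q ?g t \<le> ?Q f t" if "0 < t" for t
      using sum_besov_quotient_slice_le[OF that p fm, of "{j}"] p by (simp add: epowr_le_iff)
    then show "eventually (\<lambda>t. ?Q ?g t \<le> ?Q f t) (at_right 0)"
      using eventually_at_right_less[of "0::real"] by (auto elim!: eventually_mono)
  qed
  ultimately show ?thesis
    using fp lim by (auto simp: sobolev_BV_def besov_def Lp_fun_def intro: le_less_trans)
qed

lemma Var_finite:
  assumes "f \<in> sobolev_BV M k p" shows "Var M k p f < \<top>"
proof -
  have "Var M k p f \<le> Limsup (at_right 0) (besov_quotient M k p (critical_exponent M k p) f)"
    unfolding Var_def by (rule Liminf_le_Limsup) simp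
  then show ?thesis using assms by (auto simp: sobolev_BV_def besov_def intro: le_less_trans)
qed


text \<open>If \<open>m\<^sub>j = 0\<close>, the next level set is null as well. Otherwise the time \<open>t\<close> with \<open>t\<^sup>\<beta> = 2 C\<^sub>h m\<^sub>j\<close> is the one
  at which the kernel bound \<open>C\<^sub>h t\<^sup>-\<^sup>\<beta>\<close> times the \<open>L\<^sup>1\<close>-bound \<open>2\<^sup>j m\<^sub>j\<close> of the slice is half the height
  \<open>2\<^sup>j\<close> of the slice. The factor \<open>t\<^sup>\<alpha>\<^sup>p\<close> from the pseudo-Poincare inequality then becomes \<open>(2 C\<^sub>h m\<^sub>j)\<^sup>d\<close>.\<close>

lemma slice_superlevel_bound:
  assumes C\<^sub>h: "0 < C\<^sub>h" and \<beta>: "0 < \<beta>"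
    and ub: "\<And>t. 0 < t \<Longrightarrow> AE (x, y) in M \<Otimes>\<^sub>M M. k t x y \<le> C\<^sub>h * t powr (- \<beta>)"
    and p: "1 \<le> p"
    and C: "0 < C" "\<And>t f. 0 \<le> t \<Longrightarrow> f \<in> sobolev_BV M k p \<Longrightarrow>
        Lp_norm M (ennreal p) (\<lambda>x. P t f x - f x) \<le> ennreal (C * t powr critical_exponent M k p) * Var M k p f"
    and f: "f \<in> sobolev_BV M k p"
    and m: "\<And>j. emeasure M {x \<in> space M. 2 powr real_of_int j < \<bar>f x\<bar>} = ennreal (m j)" "\<And>j. 0 \<le> m j"
    and v: "epowr (Var M k p (\<lambda>x. dyadic_slice j (f x))) p = ennreal v" "0 \<le> v"
    and d: "d = p * critical_exponent M k p / \<beta>"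
  shows "2 powr ((real_of_int j - 1) * p) * m (j + 1) \<le> C powr p * (2 * C\<^sub>h) powr d * m j powr d * v"
proof (cases "m j = 0")
  case True
  have fm[measurable]: "f \<in> borel_measurable M"
    using f by (auto simp: sobolev_BV_def besov_def Lp_fun_def)
  have pos: "0 < (2::real) powr j" by simp
  have "2 powr real_of_int j < u" if "2 powr real_of_int (j + 1) < u" for u :: real
    using that pos unfolding two_powr_int_Suc by linarith
  then have "emeasure M {x \<in> space M. 2 powr real_of_int (j + 1) < \<bar>f x\<bar>}
      \<le> emeasure M {x \<in> space M. 2 powr real_of_int j < \<bar>f x\<bar>}"
    by (intro emeasure_mono) (auto simp del: of_int_add)
  then have "m (j + 1) \<le> 0" unfolding m True by (simp add: m ennreal_eq_0_iff)
  with m(2)[of "j + 1"] show ?thesis using True by simp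
next
  case False
  then have mj: "0 < m j" using m(2)[of j] by simp
  let ?\<alpha> = "critical_exponent M k p"
  let ?g = "\<lambda>x. dyadic_slice j (f x)"
  define l :: real where "l = 2 powr (real_of_int j - 1)"
  have l0: "0 < l" by (simp add: l_def)
  have l2: "2 powr real_of_int j = 2 * l" by (simp add: l_def powr_diff)
  define t where "t = (2 * C\<^sub>h * m j) powr (1 / \<beta>)"
  have t: "0 < t" using mj C\<^sub>h by (simp add: t_def)
  have fm[measurable]: "f \<in> borel_measurable M"
    using f by (auto simp: sobolev_BV_def besov_def Lp_fun_def)
  have g: "?g \<in> sobolev_BV M k p" by (rule slice_in_sobolev_BV[OF p f])
  then have gp: "?g \<in> Lp_fun M (ennreal p)" by (simp add: sobolev_BV_def besov_def)
  have "(\<integral>\<^sup>+x. ennreal (?g x) \<partial>M)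
      \<le> (\<integral>\<^sup>+x. ennreal (2 * l) * indicator {x \<in> space M. 2 powr real_of_int j < \<bar>f x\<bar>} x \<partial>M)"
    by (intro nn_integral_mono) (auto simp: indicator_def dyadic_slice_def l2 intro!: ennreal_leI)
  also have "\<dots> = ennreal (2 * l * m j)"
    using l0 m by (simp add: nn_integral_cmult_indicator ennreal_mult)
  finally have g1: "(\<integral>\<^sup>+x. ennreal (?g x) \<partial>M) \<le> ennreal (2 * l * m j)" .
  have "AE x in M. P t ?g x \<le> C\<^sub>h * t powr (- \<beta>) * (2 * l * m j)"
    using p l0 m C\<^sub>h by (intro heat_le_of_kernel_le[OF t _ gp _ g1 _ ub[OF t]]) (auto simp: dyadic_slice_nonneg)
  moreover have "C\<^sub>h * t powr (- \<beta>) * (2 * l * m j) = l"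
    using mj C\<^sub>h \<beta> by (simp add: t_def powr_powr powr_minus field_simps)
  ultimately have Pl: "AE x in M. P t ?g x \<le> l" by simp
  have sub: "{x \<in> space M. 2 powr real_of_int (j + 1) < \<bar>f x\<bar>} \<subseteq> {x \<in> space M. 2 * l \<le> ?g x}"
    unfolding two_powr_int_Suc by (auto simp: dyadic_slice_def l2)
  have [measurable]: "?g \<in> borel_measurable M" using gp by (simp add: Lp_fun_def)
  have "ennreal (l powr p * m (j + 1)) \<le> ennreal (l powr p) * emeasure M {x \<in> space M. 2 * l \<le> ?g x}"
    unfolding ennreal_mult[OF powr_ge_zero m(2)] m(1)[symmetric] using sub
    by (intro mult_left_mono emeasure_mono) auto
  also have "\<dots> \<le> epowr (Lp_norm M (ennreal p) (\<lambda>x. P t ?g x - ?g x)) p"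
    by (rule emeasure_superlevel_le[OF t p gp dyadic_slice_nonneg l0 Pl])
  also have "\<dots> \<le> epowr (ennreal (C * t powr ?\<alpha>) * Var M k p ?g) p"
    using p t C(2)[OF _ g, of t] by (intro epowr_mono) auto
  also have "\<dots> = ennreal ((C * t powr ?\<alpha>) powr p * v)"
    using p C t v by (simp add: epowr_mult epowr_ennreal ennreal_mult powr_mult)
  also have "(C * t powr ?\<alpha>) powr p = C powr p * ((2 * C\<^sub>h) powr d * m j powr d)"
    using C mj C\<^sub>h by (simp add: powr_mult t_def powr_powr d mult.commute)
  finally have "l powr p * m (j + 1) \<le> C powr p * ((2 * C\<^sub>h) powr d * m j powr d) * v"
    using v by (subst (asm) ennreal_le_iff) auto
  then show ?thesis by (simp add: l_def powr_powr mult_ac)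
qed

section \<open>The Sobolev inequality and its interpolation\<close>

text \<open>The endpoint \<open>\<theta> = 1\<close> of the scale. The constants fit together because \<open>q (1 - d) = p\<close>: the root
  \<open>1/q\<close> of the power \<open>1/(1 - d)\<close> of \<open>K V\<^sup>p\<close> is \<open>K\<^sup>1\<^sup>/\<^sup>p V\<close>.\<close>

theorem Sobolev_inequality:
  assumes C\<^sub>h: "0 < C\<^sub>h" and \<beta>: "0 < \<beta>"
    and ub: "\<And>t. 0 < t \<Longrightarrow> AE (x, y) in M \<Otimes>\<^sub>M M. k t x y \<le> C\<^sub>h * t powr (- \<beta>)"
    and p: "1 \<le> p" and PPI: "PPI M P k p"
    and \<alpha>: "0 \<le> critical_exponent M k p" "p * critical_exponent M k p < \<beta>"
    and q: "1 / q = 1 / p - critical_exponent M k p / \<beta>"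
  shows "\<exists>C>0. \<forall>f\<in>sobolev_BV M k p. Lp_norm M (ennreal q) f \<le> ennreal C * Var M k p f"
proof -
  obtain C where C: "0 < C" "\<And>t f. 0 \<le> t \<Longrightarrow> f \<in> sobolev_BV M k p \<Longrightarrow>
        Lp_norm M (ennreal p) (\<lambda>x. P t f x - f x) \<le> ennreal (C * t powr critical_exponent M k p) * Var M k p f"
    using PPI unfolding PPI_def by auto
  define d where "d = p * critical_exponent M k p / \<beta>"
  have d: "0 \<le> d" "d < 1" using \<alpha> \<beta> p by (simp_all add: d_def)
  have "1 / q = (1 - d) / p" unfolding q d_def using p \<beta> by (simp add: field_simps)
  then have qd: "q * (1 - d) = p" using d p by (cases "q = 0") (auto simp: field_simps)
  have qp: "p \<le> q" and q0: "0 < q"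
  proof -
    show "0 < q" using qd d p by (metis less_diff_eq add_0 zero_less_mult_pos2 less_le_trans zero_less_one)
    then have "0 \<le> q * d" using d by simp
    then show "p \<le> q" using qd by (simp add: algebra_simps)
  qed
  define K where "K = 2 powr (q + p) * (C powr p * (2 * C\<^sub>h) powr d)"
  have K0: "0 < K" using C C\<^sub>h by (simp add: K_def)
  have "Lp_norm M (ennreal q) f \<le> ennreal (2 * K powr (1 / p)) * Var M k p f" if f: "f \<in> sobolev_BV M k p" for f
  proof -
    have fm[measurable]: "f \<in> borel_measurable M" and fp: "Lp_norm M (ennreal p) f < \<top>"
      using f by (auto simp: sobolev_BV_def besov_def Lp_fun_def)
    define A where "A = enn2real (\<integral>\<^sup>+x. ennreal (\<bar>f x\<bar> powr p) \<partial>M)"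
    have "(\<integral>\<^sup>+x. ennreal (\<bar>f x\<bar> powr p) \<partial>M) < \<top>"
      using fp p by (simp add: Lp_norm_less_top_iff)
    then have A: "(\<integral>\<^sup>+x. ennreal (\<bar>f x\<bar> powr p) \<partial>M) = ennreal A" "0 \<le> A" by (simp_all add: A_def)
    define E where "E j = emeasure M {x \<in> space M. 2 powr real_of_int j < \<bar>f x\<bar>}" for j
    define m where "m j = enn2real (E j)" for j
    have m0: "0 \<le> m j" for j by (simp add: m_def)
    have mark: "ennreal (2 powr (real_of_int j * p)) * E j \<le> ennreal A" for j
      using Markov_powr[OF fm, of p "2 powr real_of_int j"] p unfolding E_def A by (simp add: powr_powr)
    have m: "E j = ennreal (m j)" for j
      using mark[of j] by (cases "E j") (auto simp: m_def ennreal_mult_top top_unique)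
    have mA: "2 powr (real_of_int j * p) * m j \<le> A" for j
      using mark[of j] m0[of j] A(2) unfolding m by (simp add: ennreal_mult[symmetric])
    define V where "V = enn2real (Var M k p f)"
    have V: "Var M k p f = ennreal V" "0 \<le> V" using Var_finite[OF f] by (simp_all add: V_def)
    define v where "v j = enn2real (epowr (Var M k p (\<lambda>x. dyadic_slice j (f x))) p)" for j
    have v: "epowr (Var M k p (\<lambda>x. dyadic_slice j (f x))) p = ennreal (v j)" "0 \<le> v j" for j
      using Var_finite[OF slice_in_sobolev_BV[OF p f, of j]] p epowr_eq_top_iff[of p]
      by (simp_all add: v_def less_top[symmetric])
    have sumv: "sum v I \<le> V powr p" if "finite I" for I
      using sum_Var_slice_le[OF p fm that] p V unfolding v
      by (simp add: v(2) epowr_ennreal sum_nonneg)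
    define b where "b j = 2 powr (real_of_int j * q) * m j" for j
    have b0: "0 \<le> b j" for j by (simp add: b_def m0)
    have rec: "b (j + 1) \<le> K * b j powr d * v j" for j
    proof -
      have "b (j + 1) = 2 powr ((real_of_int j + 1) * q - (real_of_int j - 1) * p)
          * (2 powr ((real_of_int j - 1) * p) * m (j + 1))"
        by (simp add: b_def powr_add[symmetric] mult.assoc[symmetric])
      also have "\<dots> \<le> 2 powr ((real_of_int j + 1) * q - (real_of_int j - 1) * p)
          * (C powr p * (2 * C\<^sub>h) powr d * m j powr d * v j)"
        using slice_superlevel_bound[OF C\<^sub>h \<beta> ub p C f m[unfolded E_def] m0 v d_def]
        by (intro mult_left_mono) auto
      also have "(real_of_int j + 1) * q - (real_of_int j - 1) * p = (q + p) + real_of_int j * q * d"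
        unfolding qd[symmetric] by (simp add: algebra_simps)
      also have "2 powr ((q + p) + real_of_int j * q * d) * (C powr p * (2 * C\<^sub>h) powr d * m j powr d * v j)
          = K * b j powr d * v j"
        by (simp add: K_def b_def powr_add powr_mult powr_powr m0 mult_ac)
      finally show ?thesis .
    qed
    \<comment> \<open>Integrability of \<open>|f|\<^sup>p\<close> controls \<open>b\<close> towards \<open>-\<infinity>\<close> because \<open>q \<ge> p\<close>.\<close>
    have bdd: "bdd_above (b ` {..N})" for N
    proof (rule bdd_aboveI2)
      fix j assume j: "j \<in> {..N}"
      have "b j = 2 powr (real_of_int j * (q - p)) * (2 powr (real_of_int j * p) * m j)"
        by (simp add: b_def powr_add[symmetric] mult.assoc[symmetric] algebra_simps)
      also have "\<dots> \<le> 2 powr (real_of_int N * (q - p)) * A"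
        using j qp mA m0 by (intro mult_mono powr_mono mult_right_mono) auto
      finally show "b j \<le> 2 powr (real_of_int N * (q - p)) * A" .
    qed
    have "(\<integral>\<^sup>+x. ennreal (\<bar>f x\<bar> powr q) \<partial>M) \<le> ennreal (2 powr q) * ennreal ((K * V powr p) powr (1 / (1 - d)))"
    proof (rule nn_integral_powr_le_dyadic_sum[OF fm q0])
      fix I :: "int set" assume I: "finite I"
      have "(\<Sum>j\<in>I. ennreal (2 powr (real_of_int j * q)) * E j) = ennreal (sum b I)"
        by (simp add: m b_def m0 ennreal_mult[symmetric] sum_nonneg)
      also have "\<dots> \<le> ennreal ((K * V powr p) powr (1 / (1 - d)))"
        using K0 by (intro ennreal_leI recursion_sum_bound[OF d _ b0 v(2) rec bdd sumv I]) auto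
      finally show "(\<Sum>j\<in>I. ennreal (2 powr (real_of_int j * q))
          * emeasure M {x \<in> space M. 2 powr real_of_int j < \<bar>f x\<bar>}) \<le> ennreal ((K * V powr p) powr (1 / (1 - d)))"
        by (simp add: E_def)
    qed
    then have "Lp_norm M (ennreal q) f
        \<le> epowr (ennreal (2 powr q) * ennreal ((K * V powr p) powr (1 / (1 - d)))) (1 / q)"
      using q0 by (simp add: Lp_norm_ennreal epowr_mono)
    also have "\<dots> = ennreal (2 * ((K * V powr p) powr (1 / (1 - d) * (1 / q))))"
      using q0 by (simp add: epowr_mult epowr_ennreal powr_powr ennreal_mult)
    also have "1 / (1 - d) * (1 / q) = 1 / p" using qd by (simp add: mult.commute)
    also have "(K * V powr p) powr (1 / p) = K powr (1 / p) * V"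
      using p V by (simp add: powr_mult powr_powr)
    finally show ?thesis using V by (simp add: ennreal_mult[symmetric] mult_ac)
  qed
  then show ?thesis using K0 by (intro exI[of _ "2 * K powr (1 / p)"]) auto
qed

end

text \<open>The constant of the Sobolev inequality appears to the power \<open>\<theta>\<close>; replacing it by its maximum with
  \<open>1\<close> makes it serve all \<open>\<theta>\<close> at once, and it depends on neither \<open>r\<close> nor \<open>s\<close>.\<close>

theorem corollary4p2:
  fixes M :: "'a measure"
    and E :: "('a \<Rightarrow> real) \<Rightarrow> ('a \<Rightarrow> real) \<Rightarrow> real"
    and F :: "('a \<Rightarrow> real) set"
    and P :: "real \<Rightarrow> ('a \<Rightarrow> real) \<Rightarrow> 'a \<Rightarrow> real"
    and k :: "real \<Rightarrow> 'a \<Rightarrow> 'a \<Rightarrow> real"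
    and p \<beta> C\<^sub>h :: real
  assumes "heat_dirichlet_space M E F P k"
    and "0 < C\<^sub>h" and "0 < \<beta>"
    and "\<And>t. 0 < t \<Longrightarrow> AE (x, y) in M \<Otimes>\<^sub>M M. k t x y \<le> C\<^sub>h * t powr (- \<beta>)"
    and "1 \<le> p"
    and "nontrivial_exponents M k p \<noteq> {}" and "bdd_above (nontrivial_exponents M k p)"
    and "PPI M P k p"
    and "p * critical_exponent M k p < \<beta>"
  shows "\<forall>r s :: ennreal. 1 \<le> r \<longrightarrow> 1 \<le> s \<longrightarrow>
           (\<exists>C>0. \<forall>\<theta>. 0 < \<theta> \<longrightarrow> \<theta> \<le> 1 \<longrightarrow>
              enn2real (1 / r) = \<theta> * (1 / p - critical_exponent M k p / \<beta>) + (1 - \<theta>) * enn2real (1 / s) \<longrightarrow>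
              (\<forall>f \<in> sobolev_BV M k p.
                 Lp_norm M r f \<le> ennreal C * epowr (Var M k p f) \<theta> * epowr (Lp_norm M s f) (1 - \<theta>)))"
proof (intro allI impI)
  fix r s :: ennreal assume r: "1 \<le> r" and s: "1 \<le> s"
  interpret heat_dirichlet_space M E F P k by fact
  define \<alpha> where "\<alpha> = critical_exponent M k p"
  have \<alpha>0: "0 \<le> \<alpha>"
  proof -
    obtain a where "a \<in> nontrivial_exponents M k p" using assms(6) by blast
    then show ?thesis
      using cSup_upper[OF _ assms(7)] unfolding \<alpha>_def critical_exponent_def nontrivial_exponents_def by force
  qed
  define q where "q = 1 / (1 / p - \<alpha> / \<beta>)"
  have inv_q: "1 / q = 1 / p - \<alpha> / \<beta>" by (simp add: q_def)
  have "1 / p \<le> 1" "0 \<le> \<alpha> / \<beta>" using assms(3,5) \<alpha>0 by simp_all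
  then have "1 / p - \<alpha> / \<beta> \<le> 1" by linarith
  moreover have "0 < 1 / p - \<alpha> / \<beta>"
    using assms(3,5,9) by (simp add: \<alpha>_def field_simps)
  ultimately have q: "1 \<le> q" by (simp add: q_def)
  obtain C where C: "0 < C" "\<And>f. f \<in> sobolev_BV M k p \<Longrightarrow> Lp_norm M (ennreal q) f \<le> ennreal C * Var M k p f"
    using Sobolev_inequality[OF assms(2,3,4,5,8) _ assms(9), of q] \<alpha>0 inv_q unfolding \<alpha>_def by blast
  show "\<exists>C>0. \<forall>\<theta>. 0 < \<theta> \<longrightarrow> \<theta> \<le> 1 \<longrightarrow>
      enn2real (1 / r) = \<theta> * (1 / p - critical_exponent M k p / \<beta>) + (1 - \<theta>) * enn2real (1 / s) \<longrightarrow>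
      (\<forall>f \<in> sobolev_BV M k p.
         Lp_norm M r f \<le> ennreal C * epowr (Var M k p f) \<theta> * epowr (Lp_norm M s f) (1 - \<theta>))"
  proof (intro exI[of _ "max 1 C"] conjI allI impI ballI)
    fix \<theta> f
    assume \<theta>: "0 < \<theta>" "\<theta> \<le> 1" and f: "f \<in> sobolev_BV M k p"
      and eq: "enn2real (1 / r) = \<theta> * (1 / p - critical_exponent M k p / \<beta>) + (1 - \<theta>) * enn2real (1 / s)"
    have fm: "f \<in> borel_measurable M" using f by (simp add: sobolev_BV_def besov_def Lp_fun_def)
    have "C powr \<theta> \<le> max 1 C"
    proof -
      have "C powr \<theta> \<le> max 1 C powr \<theta>" using C \<theta> by (intro powr_mono2) auto
      also have "\<dots> \<le> max 1 C powr 1" using \<theta> by (intro powr_mono) auto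
      finally show ?thesis by simp
    qed
    then have const: "epowr (ennreal C) \<theta> \<le> ennreal (max 1 C)"
      using C \<theta> by (simp add: epowr_ennreal ennreal_leI del: max.bounded_iff)
    have "enn2real (1 / r) = \<theta> / q + (1 - \<theta>) * enn2real (1 / s)"
      using eq inv_q unfolding \<alpha>_def by (simp add: divide_inverse)
    then have "Lp_norm M r f \<le> epowr (Lp_norm M (ennreal q) f) \<theta> * epowr (Lp_norm M s f) (1 - \<theta>)"
      by (rule Lp_norm_interpolation[OF fm q r s \<theta>])
    also have "\<dots> \<le> epowr (ennreal C * Var M k p f) \<theta> * epowr (Lp_norm M s f) (1 - \<theta>)"
      using C(2)[OF f] \<theta> by (intro mult_right_mono epowr_mono) auto
    also have "\<dots> \<le> ennreal (max 1 C) * epowr (Var M k p f) \<theta> * epowr (Lp_norm M s f) (1 - \<theta>)"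
      using const \<theta> by (simp add: epowr_mult mult_right_mono)
    finally show "Lp_norm M r f
        \<le> ennreal (max 1 C) * epowr (Var M k p f) \<theta> * epowr (Lp_norm M s f) (1 - \<theta>)" .
  qed simp
qed

end
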